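(* Let $0<q<1$ and let $a,b,z$ be real numbers with $0<z<b-a<1$ and $b<1$. Then \[ \frac{\Gamma_q(b)\Gamma_q(1-a)\Gamma_q(z)\Gamma_q(b-a-z)}{\Gamma_q(b-a)\Gamma_q(a+z)\Gamma_q(1-a-z)}=-(1-q)^{a+1-b}+(1-q)^{a+1-b}\frac{\Gamma_q(b)\Gamma_q(z)}{\Gamma_q(b-a)\Gamma_q(a+z)}\sum_{n=0}^{\infty}\frac{(q^{a+1+z-b})_n(q^a)_n}{(q)_n(q^{a+z})_n}(q^{b-a})^n + \frac{\Gamma_q(1-a)\Gamma_q(b-a-z)}{\Gamma_q(1-b)\Gamma_q(b+1-a-z)}\sum_{n=0}^{\infty}\frac{(q^{b-a})_n(q^{b-z-a})_n}{(q^{b+1-a-z})_n(q)_n}(q^{1-b})^n . \]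
   Context: For $0<q<1$ and complex $x$, $(x)_\infty=\prod_{k=0}^{\infty}(1-xq^k)$ and $(x)_n=(x)_\infty/(xq^n)_\infty$. The $q$-gamma function (Jackson) is $\Gamma_q(x)=\frac{(q)_\infty}{(q^x)_\infty}(1-q)^{1-x}$ for $0<q<1$.
   Formalization: The formal statement additionally assumes that neither b nor a+z is a nonpositive integer, since there Γ_q(b), respectively Γ_q(a+z) and the terms with (q^{a+z})_n in the denominator, are undefined. *)

theory Defs
  imports "HOL-Analysis.Analysis"
begin

text \<open>
  The base \<open>q\<close> is real. The argument \<open>x\<close> ranges over a type that can be instantiated with the reals
  or the complex numbers; powers of \<open>q\<close> are embedded by \<^const>\<open>of_real\<close>.
\<close>

definition qpoch_inf :: "real \<Rightarrow> 'a \<Rightarrow> 'a::{banach, real_normed_field}"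
  where "qpoch_inf q x = (\<Prod>k. 1 - x * of_real q ^ k)"

text \<open>
  \<open>(x)\<^sub>n = (x)\<^sub>\<infinity> / (x q\<^sup>n)\<^sub>\<infinity>\<close>. The quotient has the form \<open>0/0\<close> if \<open>x = q\<^sup>-\<^sup>m\<close> with \<open>m \<ge> n\<close>
  (for example \<open>x = 1\<close>, \<open>n = 0\<close>); there \<open>(x)\<^sub>n\<close> has its usual value \<open>(1 - x)\<dots>(1 - x q\<^sup>n\<^sup>-\<^sup>1)\<close>.
  The lemma \<open>qpoch_eq_prod\<close> below shows that this is the same formula in both cases.
\<close>

definition qpoch :: "real \<Rightarrow> 'a \<Rightarrow> nat \<Rightarrow> 'a::{banach, real_normed_field}"
  where "qpoch q x n =
    (if qpoch_inf q (x * of_real q ^ n) = 0 then (\<Prod>k<n. 1 - x * of_real q ^ k)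
     else qpoch_inf q x / qpoch_inf q (x * of_real q ^ n))"

definition Gamma_q :: "real \<Rightarrow> 'a \<Rightarrow> 'a::{ln, real_normed_field}"
  where "Gamma_q q x =
    qpoch_inf q (of_real q) / qpoch_inf q (of_real q powr x) * of_real (1 - q) powr (1 - x)"

lemma convergent_prod_qpoch_inf:
  fixes x :: "'a::{banach, real_normed_field}"
  assumes "0 < q" "q < 1"
  shows "convergent_prod (\<lambda>k. 1 - x * of_real q ^ k)"
proof -
  have "summable (\<lambda>k. norm x * q ^ k)"
    using assms by (intro summable_mult summable_geometric) auto
  then have "summable (\<lambda>k. norm ((1 - x * of_real q ^ k) - 1))"
    using assms by (simp add: norm_mult norm_power)
  then show ?thesis
    by (intro abs_convergent_prod_imp_convergent_prod)
       (simp add: abs_convergent_prod_conv_summable)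
qed

lemma qpoch_inf_split:
  fixes x :: "'a::{banach, real_normed_field}"
  assumes "0 < q" "q < 1"
  shows "qpoch_inf q x = (\<Prod>k<n. 1 - x * of_real q ^ k) * qpoch_inf q (x * of_real q ^ n)"
proof (induction n)
  case (Suc n)
  have lim: "(\<lambda>m. \<Prod>k\<le>m. 1 - y * of_real q ^ k) \<longlonglongrightarrow> qpoch_inf q y" for y :: 'a
    unfolding qpoch_inf_def
    by (rule convergent_prod_LIMSEQ[OF convergent_prod_qpoch_inf[OF assms]])
  have step: "qpoch_inf q y = (1 - y) * qpoch_inf q (y * of_real q)" for y :: 'a
  proof (rule LIMSEQ_unique)
    show "(\<lambda>m. \<Prod>k\<le>Suc m. 1 - y * of_real q ^ k) \<longlonglongrightarrow> qpoch_inf q y"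
      using lim[of y] by (rule LIMSEQ_Suc)
    have "(\<lambda>m. \<Prod>k\<le>Suc m. 1 - y * of_real q ^ k) =
          (\<lambda>m. (1 - y) * (\<Prod>k\<le>m. 1 - (y * of_real q) * of_real q ^ k))"
      by (simp add: prod.atMost_Suc_shift mult.assoc del: prod.atMost_Suc)
    then show "(\<lambda>m. \<Prod>k\<le>Suc m. 1 - y * of_real q ^ k)
        \<longlonglongrightarrow> (1 - y) * qpoch_inf q (y * of_real q)"
      using tendsto_mult_left[OF lim[of "y * of_real q"], of "1 - y"] by simp
  qed
  show ?case
    using Suc.IH step[of "x * of_real q ^ n"] by (simp add: mult_ac)
qed simp

lemma qpoch_eq_prod:
  fixes x :: "'a::{banach, real_normed_field}"
  assumes "0 < q" "q < 1"
  shows "qpoch q x n = (\<Prod>k<n. 1 - x * of_real q ^ k)"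
  using qpoch_inf_split[OF assms, of x n] by (simp add: qpoch_def)

end

theory Submission
  imports Defs
begin

text \<open>
  Put \<open>A = q\<^sup>a\<close>, \<open>B = q\<^sup>b\<close>, \<open>Z = q\<^sup>z\<close>. After division by \<open>(1 - q)\<^sup>a\<^sup>+\<^sup>1\<^sup>-\<^sup>b\<close> the claim is Ramanujan's
  \<open>1\<psi>1\<close> summation of \<open>\<Sum>n\<in>\<int>. (A)\<^sub>n / (B)\<^sub>n Z\<^sup>n\<close>: the first series on the right is the Heine transform of the
  part with \<open>n \<ge> 0\<close>, the second one that of the part with \<open>n \<le> 0\<close>, and the summand \<open>-1\<close> corrects for
  counting \<open>n = 0\<close> twice.

  Heine's usual double-sum argument would need \<open>A < 1\<close>, which may fail here. Instead,
  \<open>P(A) = \<Sum>n\<ge>0. (A)\<^sub>n / (Ac)\<^sub>n Z\<^sup>n\<close> is the only solution of \<open>P(A) = 1 + Z (1 - A) / (1 - Ac) P(Aq)\<close> that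
  converges along \<open>A q\<^sup>N\<close>; the transformed series solves the same recurrence by the \<open>q\<close>-Gauss sum
  (respectively the \<open>q\<close>-binomial theorem). The bilateral sum \<open>f(b)\<close> satisfies
  \<open>(1 - b) (1 - b / (AZ)) f(b) = (1 - b / A) f(bq)\<close>, so iteration determines it up to the constant
  \<open>f(0)\<close>, which is read off from \<open>b = q\<close>, where \<open>f\<close> is a \<open>q\<close>-binomial series.
\<close>

section \<open>Series with a geometric majorant\<close>

lemma summable_geometric_bound:
  fixes f :: "nat \<Rightarrow> real"
  assumes "\<And>n. \<bar>f n\<bar> \<le> C * r ^ n" "0 \<le> r" "r < 1"
  shows "summable f"
proof (rule summable_comparison_test')
  show "summable (\<lambda>n. C * r ^ n)"
    using assms(2,3) by (intro summable_mult summable_geometric) auto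
  show "norm (f n) \<le> C * r ^ n" if "n \<ge> 0" for n
    using assms(1)[of n] by simp
qed

text \<open>Tannery's theorem. The majorant does not depend on \<open>N\<close>, which is what
  allows limits along arguments such as \<open>A * q ^ N\<close> to be taken term by term.\<close>

lemma tendsto_suminf_geometric_bound:
  fixes f :: "nat \<Rightarrow> nat \<Rightarrow> real"
  assumes "\<And>n. (\<lambda>N. f N n) \<longlonglongrightarrow> g n"
    and "\<And>N n. \<bar>f N n\<bar> \<le> C * r ^ n" "0 \<le> r" "r < 1"
  shows "(\<lambda>N. \<Sum>n. f N n) \<longlonglongrightarrow> (\<Sum>n. g n)"
proof -
  have "\<forall>\<^sub>F (n, N) in sequentially \<times>\<^sub>F sequentially. norm (f N n) \<le> C * r ^ n"
    using assms(2) by (intro always_eventually) auto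
  moreover have "summable (\<lambda>n. C * r ^ n)"
    using assms(3,4) by (intro summable_mult summable_geometric) auto
  ultimately show ?thesis
    using tannerys_theorem[OF assms(1)] by simp
qed

section \<open>q-shifted factorials: recurrences, limits and zeros\<close>

locale q_base =
  fixes q :: real
  assumes q_pos: "0 < q" and q_less_1: "q < 1"
begin

lemma qpoch_prod: "qpoch q x n = (\<Prod>k<n. 1 - x * q ^ k)" for x :: real
  using qpoch_eq_prod[OF q_pos q_less_1, of x n] by simp

lemma qpoch_0 [simp]: "qpoch q x 0 = 1" for x :: real
  by (simp add: qpoch_prod)

lemma qpoch_zero [simp]: "qpoch q 0 n = (1 :: real)"
  by (simp add: qpoch_prod)

lemma qpoch_Suc: "qpoch q x (Suc n) = qpoch q x n * (1 - x * q ^ n)" for x :: real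
  by (simp add: qpoch_prod)

lemma qpoch_Suc_left: "qpoch q x (Suc n) = (1 - x) * qpoch q (x * q) n" for x :: real
  by (simp add: qpoch_prod prod.lessThan_Suc_shift mult.assoc del: prod.lessThan_Suc)

lemma qpoch_inf_shift: "qpoch_inf q x = qpoch q x n * qpoch_inf q (x * q ^ n)" for x :: real
  using qpoch_inf_split[OF q_pos q_less_1, of x n] by (simp add: qpoch_prod)

lemma qpoch_inf_Suc: "qpoch_inf q x = (1 - x) * qpoch_inf q (x * q)" for x :: real
  using qpoch_inf_shift[of x 1] by (simp add: qpoch_prod)

lemma qpoch_tendsto: "(\<lambda>n. qpoch q x n) \<longlonglongrightarrow> qpoch_inf q x" for x :: real
proof -
  have "(\<lambda>m. \<Prod>k\<le>m. 1 - x * q ^ k) \<longlonglongrightarrow> qpoch_inf q x"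
    using convergent_prod_LIMSEQ[OF convergent_prod_qpoch_inf[OF q_pos q_less_1, of x]]
    by (simp add: qpoch_inf_def)
  then have "(\<lambda>m. qpoch q x (Suc m)) \<longlonglongrightarrow> qpoch_inf q x"
    by (simp add: qpoch_prod lessThan_Suc_atMost del: prod.lessThan_Suc)
  then show ?thesis by (rule LIMSEQ_imp_Suc)
qed

lemma qpoch_inf_nonzero:
  fixes x :: real
  assumes "\<And>k. x * q ^ k \<noteq> 1"
  shows "qpoch_inf q x \<noteq> 0"
  unfolding qpoch_inf_def
  using assms convergent_prod_qpoch_inf[OF q_pos q_less_1, of x]
  by (intro prodinf_nonzero) auto

lemma qpoch_inf_nonzero_small:
  fixes x :: real
  assumes "\<bar>x\<bar> < 1"
  shows "qpoch_inf q x \<noteq> 0"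
proof (rule qpoch_inf_nonzero)
  fix k
  have "\<bar>x * q ^ k\<bar> \<le> \<bar>x\<bar> * 1"
    unfolding abs_mult using q_pos q_less_1 by (intro mult_left_mono) (auto simp: power_le_one)
  then show "x * q ^ k \<noteq> 1" using assms by auto
qed

lemma qpoch_inf_q_nonzero [simp]: "qpoch_inf q q \<noteq> 0"
  using q_pos q_less_1 by (intro qpoch_inf_nonzero_small) auto

lemma qpoch_inf_nonzero_shift:
  fixes x :: real
  assumes "qpoch_inf q x \<noteq> 0"
  shows "qpoch_inf q (x * q ^ n) \<noteq> 0" "qpoch q x n \<noteq> 0" "1 - x * q ^ n \<noteq> 0"
  using assms qpoch_inf_shift[of x n] qpoch_inf_shift[of x "Suc n"] by (auto simp: qpoch_Suc)

lemma qpoch_q_nonzero [simp]: "qpoch q q n \<noteq> 0"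
  by (intro qpoch_inf_nonzero_shift) simp

lemma mult_power_tendsto_0: "(\<lambda>N. x * q ^ N) \<longlonglongrightarrow> 0" for x :: real
  using q_pos q_less_1 by (intro tendsto_mult_right_zero LIMSEQ_realpow_zero) auto

lemma qpoch_shift_tendsto_1: "(\<lambda>N. qpoch q (x * q ^ N) n) \<longlonglongrightarrow> 1" for x :: real
proof -
  have "(\<lambda>N. \<Prod>k<n. 1 - x * q ^ N * q ^ k) \<longlonglongrightarrow> (\<Prod>k<n. 1 - 0 * q ^ k)"
    by (intro tendsto_intros mult_power_tendsto_0)
  then show ?thesis by (simp add: qpoch_prod)
qed

section \<open>Uniform bounds for q-shifted factorials\<close>

lemma abs_shift_le: "\<bar>x * q ^ N\<bar> \<le> \<bar>x\<bar>"
  unfolding abs_mult using q_pos q_less_1 by (intro mult_left_le) (auto simp: power_le_one)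

text \<open>Each factor has modulus at most \<open>1 + X * q ^ k\<close>; these majorants are at
  least 1, so their partial products increase to the infinite product at \<open>- X\<close>.\<close>

lemma abs_qpoch_le:
  fixes x :: real
  assumes "\<bar>x\<bar> \<le> X"
  shows "\<bar>qpoch q x n\<bar> \<le> qpoch_inf q (- X)"
proof -
  have X: "0 \<le> X" using assms by linarith
  have "\<bar>qpoch q x n\<bar> = (\<Prod>k<n. \<bar>1 - x * q ^ k\<bar>)"
    by (simp add: qpoch_prod abs_prod)
  also have "\<dots> \<le> (\<Prod>k<n. 1 - (- X) * q ^ k)"
  proof (intro prod_mono conjI)
    fix k
    have "\<bar>x * q ^ k\<bar> \<le> X * q ^ k"
      unfolding abs_mult using assms q_pos by (intro mult_mono) auto
    then show "\<bar>1 - x * q ^ k\<bar> \<le> 1 - (- X) * q ^ k" by auto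
  qed auto
  also have "\<dots> = qpoch q (- X) n" by (simp add: qpoch_prod)
  also have "\<dots> \<le> qpoch_inf q (- X)"
  proof (rule incseq_le[OF _ qpoch_tendsto])
    show "incseq (qpoch q (- X))"
    proof (rule incseq_SucI)
      fix m
      have "0 \<le> qpoch q (- X) m"
        using X q_pos by (auto simp: qpoch_prod intro!: prod_nonneg add_nonneg_nonneg)
      then show "qpoch q (- X) m \<le> qpoch q (- X) (Suc m)"
        unfolding qpoch_Suc using X q_pos by (simp add: mult_le_cancel_left1)
    qed
  qed
  finally show ?thesis .
qed

text \<open>In \<open>(x)_inf = (x)_N (x q^N)_n (x q^(N+n))_inf\<close> the first and the last
  factor on the right are bounded above uniformly, so a nonzero left side keeps the middle one away
  from 0.\<close>

lemma qpoch_lower_bound: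
  fixes x :: real
  assumes x: "qpoch_inf q x \<noteq> 0"
  obtains L where "L > 0" "\<And>N n. L \<le> \<bar>qpoch q (x * q ^ N) n\<bar>"
proof -
  \<comment> \<open>The summand 1 makes \<open>?M\<close> positive, hence usable as a
    denominator.\<close>
  let ?I = "\<bar>qpoch_inf q x\<bar>" and ?M = "1 + qpoch_inf q (- \<bar>x\<bar>)"
  have M0: "0 \<le> qpoch_inf q (- \<bar>x\<bar>)"
    using abs_qpoch_le[of x "\<bar>x\<bar>" 0] by simp
  have ub: "\<bar>qpoch_inf q (x * q ^ n)\<bar> \<le> ?M" for n
  proof (rule LIMSEQ_le_const2)
    show "(\<lambda>m. \<bar>qpoch q (x * q ^ n) m\<bar>) \<longlonglongrightarrow> \<bar>qpoch_inf q (x * q ^ n)\<bar>"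
      by (intro tendsto_rabs qpoch_tendsto)
    show "\<exists>N. \<forall>m\<ge>N. \<bar>qpoch q (x * q ^ n) m\<bar> \<le> ?M"
      by (intro exI allI impI add_increasing abs_qpoch_le abs_shift_le) auto
  qed
  have "?I / (?M * ?M) \<le> \<bar>qpoch q (x * q ^ N) n\<bar>" for N n
  proof -
    have "?I = \<bar>qpoch q (x * q ^ N) n\<bar> * (\<bar>qpoch q x N\<bar> * \<bar>qpoch_inf q (x * q ^ (N + n))\<bar>)"
      using qpoch_inf_shift[of x N] qpoch_inf_shift[of "x * q ^ N" n]
      by (simp add: abs_mult power_add mult_ac)
    also have "\<dots> \<le> \<bar>qpoch q (x * q ^ N) n\<bar> * (?M * ?M)"
      using abs_qpoch_le[of x "\<bar>x\<bar>" N] ub M0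
      by (intro mult_left_mono mult_mono) (auto intro: add_increasing)
    finally show ?thesis using M0 by (intro divide_le_eq[THEN iffD2]) auto
  qed
  moreover have "?I / (?M * ?M) > 0" using x M0 by simp
  ultimately show ?thesis using that by blast
qed

text \<open>The shifts \<open>N\<close> and \<open>M\<close> vary independently, so one bound serves
  whether both parameters move, only one does, or neither.\<close>

lemma qpoch_ratio_bound:
  fixes x y :: real
  assumes "qpoch_inf q y \<noteq> 0"
  obtains C where "C \<ge> 0" "\<And>N M n. \<bar>qpoch q (x * q ^ N) n / qpoch q (y * q ^ M) n\<bar> \<le> C"
proof -
  obtain L where L: "L > 0" "\<And>N n. L \<le> \<bar>qpoch q (y * q ^ N) n\<bar>"
    using qpoch_lower_bound[OF assms] by blast
  let ?C = "qpoch_inf q (- \<bar>x\<bar>) / L"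
  have nn: "0 \<le> qpoch_inf q (- \<bar>x\<bar>)"
    using abs_qpoch_le[of x "\<bar>x\<bar>" 0] by simp
  have "\<bar>qpoch q (x * q ^ N) n / qpoch q (y * q ^ M) n\<bar> \<le> ?C" for N M n
    unfolding abs_divide
    using abs_qpoch_le[OF abs_shift_le[of x N], of n] L nn by (intro frac_le) auto
  then show ?thesis using that[of ?C] nn L by auto
qed

section \<open>The q-binomial theorem\<close>

lemma summable_q_binomial:
  fixes a x :: real
  assumes "\<bar>x\<bar> < 1"
  shows "summable (\<lambda>n. qpoch q a n / qpoch q q n * x ^ n)"
proof -
  obtain C where C: "C \<ge> 0" "\<And>N M n. \<bar>qpoch q (a * q ^ N) n / qpoch q (q * q ^ M) n\<bar> \<le> C"
    by (rule qpoch_ratio_bound[OF qpoch_inf_q_nonzero, of a]) blast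
  show ?thesis
  proof (rule summable_geometric_bound)
    show "\<bar>qpoch q a n / qpoch q q n * x ^ n\<bar> \<le> C * \<bar>x\<bar> ^ n" for n
      unfolding abs_mult power_abs using C(2)[of 0 n 0] by (intro mult_right_mono) auto
  qed (use assms in auto)
qed

text \<open>The series \<open>F\<close> satisfies \<open>(1 - x) F(x) = (1 - a x) F(x q)\<close>.
  Under iteration \<open>F (x * q ^ N)\<close> tends to the constant term 1, and only the two
  infinite products remain.\<close>

theorem q_binomial:
  fixes a x :: real
  assumes x: "\<bar>x\<bar> < 1"
  shows "(\<Sum>n. qpoch q a n / qpoch q q n * x ^ n) = qpoch_inf q (a * x) / qpoch_inf q x"
proof -
  define c where "c n = qpoch q a n / qpoch q q n" for n
  define F where "F x = (\<Sum>n. c n * x ^ n)" for x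
  have sm: "summable (\<lambda>n. c n * x ^ n)" if "\<bar>x\<bar> < 1" for x
    using summable_q_binomial[OF that] by (simp add: c_def)
  have sh: "\<bar>x * q ^ N\<bar> < 1" for N
    using abs_shift_le[of x N] x by linarith
  have c_Suc: "c (Suc n) * (1 - q ^ Suc n) = c n * (1 - a * q ^ n)" for n
    using qpoch_q_nonzero[of "Suc n"] by (simp add: c_def qpoch_Suc field_simps)
  have step: "(1 - x) * F x = (1 - a * x) * F (x * q)" if x: "\<bar>x\<bar> < 1" for x
  proof -
    have xq: "\<bar>x * q\<bar> < 1" using abs_shift_le[of x 1] x by simp
    have hd: "F y = 1 + (\<Sum>n. c (Suc n) * y ^ Suc n)" if "\<bar>y\<bar> < 1" for y
      using suminf_split_head[OF sm[OF that]] by (simp add: F_def c_def)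
    \<comment> \<open>Subtracting the series at \<open>x * q\<close> multiplies the coefficient of
      index n by \<open>1 - q ^ n\<close>, the last factor of \<open>(q)_n\<close>. After
      cancellation the coefficients of \<open>F\<close> reappear, one index lower.\<close>
    have "F x - F (x * q) = (\<Sum>n. c (Suc n) * x ^ Suc n - c (Suc n) * (x * q) ^ Suc n)"
      unfolding hd[OF x] hd[OF xq]
      using suminf_diff[OF sm[OF x, THEN summable_Suc_iff[THEN iffD2]]
          sm[OF xq, THEN summable_Suc_iff[THEN iffD2]]]
      by linarith
    also have "\<dots> = (\<Sum>n. x * (c n * x ^ n - a * (c n * (x * q) ^ n)))"
    proof (rule suminf_cong)
      fix n
      have "c (Suc n) * x ^ Suc n - c (Suc n) * (x * q) ^ Suc n
          = c (Suc n) * (1 - q ^ Suc n) * x ^ Suc n"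
        by (simp add: power_mult_distrib algebra_simps)
      also have "\<dots> = x * (c n * x ^ n - a * (c n * (x * q) ^ n))"
        unfolding c_Suc by (simp add: power_mult_distrib algebra_simps)
      finally show "c (Suc n) * x ^ Suc n - c (Suc n) * (x * q) ^ Suc n
          = x * (c n * x ^ n - a * (c n * (x * q) ^ n))" .
    qed
    also have "\<dots> = x * (F x - a * F (x * q))"
      unfolding F_def using sm[OF x] sm[OF xq]
      by (intro sums_unique[symmetric] sums_mult sums_diff summable_sums)
    finally show ?thesis by (simp add: algebra_simps)
  qed
  have iter: "F x * qpoch q x N = qpoch q (a * x) N * F (x * q ^ N)" for N
  proof (induction N)
    case (Suc N)
    have "F x * qpoch q x (Suc N) = qpoch q (a * x) N * ((1 - x * q ^ N) * F (x * q ^ N))"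
      using Suc by (simp add: qpoch_Suc mult_ac)
    also have "\<dots> = qpoch q (a * x) (Suc N) * F (x * q ^ Suc N)"
      unfolding step[OF sh] by (simp add: qpoch_Suc mult_ac)
    finally show ?case .
  qed simp
  obtain C where C: "C \<ge> 0" "\<And>N M n. \<bar>qpoch q (a * q ^ N) n / qpoch q (q * q ^ M) n\<bar> \<le> C"
    by (rule qpoch_ratio_bound[OF qpoch_inf_q_nonzero, of a]) blast
  have "(\<lambda>N. F (x * q ^ N)) \<longlonglongrightarrow> (\<Sum>n. c n * 0 ^ n)"
    unfolding F_def
  proof (rule tendsto_suminf_geometric_bound)
    show "(\<lambda>N. c n * (x * q ^ N) ^ n) \<longlonglongrightarrow> c n * 0 ^ n" for n
      by (intro tendsto_intros mult_power_tendsto_0)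
    show "\<bar>c n * (x * q ^ N) ^ n\<bar> \<le> C * \<bar>x\<bar> ^ n" for N n
      unfolding abs_mult[of "c n"] power_abs
      using C(1) C(2)[of 0 n 0] abs_shift_le[of x N]
      by (intro mult_mono power_mono) (auto simp: c_def)
  qed (use x in auto)
  then have "(\<lambda>N. F (x * q ^ N)) \<longlonglongrightarrow> 1"
    unfolding powser_zero by (simp add: c_def)
  then have "(\<lambda>N. qpoch q (a * x) N * F (x * q ^ N)) \<longlonglongrightarrow> qpoch_inf q (a * x) * 1"
    by (intro tendsto_mult qpoch_tendsto)
  moreover have "(\<lambda>N. F x * qpoch q x N) \<longlonglongrightarrow> F x * qpoch_inf q x"
    by (intro tendsto_mult qpoch_tendsto tendsto_const)
  ultimately have "F x * qpoch_inf q x = qpoch_inf q (a * x)"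
    unfolding iter[symmetric] by (auto dest: LIMSEQ_unique)
  then show ?thesis
    using qpoch_inf_nonzero_small[OF x] by (simp add: F_def c_def field_simps)
qed

section \<open>Bounds and limits for 2phi1 series\<close>

text \<open>The quotient \<open>qpoch_inf q x / qpoch q x N\<close> replaces continuity of the
  infinite product at 0 by convergence of its partial products; the division is where nonvanishing
  enters.\<close>

lemma qpoch_inf_shift_tendsto_1:
  fixes x :: real
  assumes "qpoch_inf q x \<noteq> 0"
  shows "(\<lambda>N. qpoch_inf q (x * q ^ N)) \<longlonglongrightarrow> 1"
proof -
  have "qpoch_inf q (x * q ^ N) = qpoch_inf q x / qpoch q x N" for N
    using qpoch_inf_shift[of x N] qpoch_inf_nonzero_shift[OF assms] by (simp add: field_simps)
  moreover have "(\<lambda>N. qpoch_inf q x / qpoch q x N) \<longlonglongrightarrow> qpoch_inf q x / qpoch_inf q x"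
    by (intro tendsto_intros qpoch_tendsto assms)
  ultimately show ?thesis using assms by simp
qed

text \<open>The coefficient splits into the quotients \<open>(d)_n / (q)_n\<close> and
  \<open>(A q^N)_n / (y q^N)_n\<close>, each bounded. \<open>A\<close> and \<open>y\<close> carry
  the same shift because the lower parameter is a multiple of \<open>A\<close> in the recurrences
  for the q-Gauss sum and Heine's second transformation.\<close>

lemma phi21_bound:
  fixes A d y :: real
  assumes "qpoch_inf q y \<noteq> 0"
  obtains C where
    "\<And>N n. \<bar>qpoch q d n * qpoch q (A * q ^ N) n / (qpoch q q n * qpoch q (y * q ^ N) n)\<bar> \<le> C"
proof -
  obtain C where C: "C \<ge> 0" "\<And>N M n. \<bar>qpoch q (d * q ^ N) n / qpoch q (q * q ^ M) n\<bar> \<le> C"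
    by (rule qpoch_ratio_bound[OF qpoch_inf_q_nonzero, of d]) blast
  obtain D where D: "D \<ge> 0" "\<And>N M n. \<bar>qpoch q (A * q ^ N) n / qpoch q (y * q ^ M) n\<bar> \<le> D"
    by (rule qpoch_ratio_bound[OF assms, of A]) blast
  have "\<bar>qpoch q d n * qpoch q (A * q ^ N) n / (qpoch q q n * qpoch q (y * q ^ N) n)\<bar> \<le> C * D"
    for N n
  proof -
    have "\<bar>(qpoch q d n / qpoch q q n) * (qpoch q (A * q ^ N) n / qpoch q (y * q ^ N) n)\<bar> \<le> C * D"
      unfolding abs_mult[of "qpoch q d n / qpoch q q n"]
      using C(1) D(1) C(2)[of 0 n 0] D(2)[of N n N] by (intro mult_mono) auto
    then show ?thesis by simp
  qed
  then show ?thesis using that by blast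
qed

lemma summable_phi21:
  fixes A c d y :: real
  assumes "qpoch_inf q y \<noteq> 0" and c: "\<bar>c\<bar> < 1"
  shows "summable (\<lambda>n. qpoch q d n * qpoch q A n / (qpoch q q n * qpoch q y n) * c ^ n)"
proof -
  obtain C where
    C: "\<And>N n. \<bar>qpoch q d n * qpoch q (A * q ^ N) n / (qpoch q q n * qpoch q (y * q ^ N) n)\<bar> \<le> C"
    by (rule phi21_bound[OF assms(1)]) blast
  show ?thesis
  proof (rule summable_geometric_bound)
    show "\<bar>qpoch q d n * qpoch q A n / (qpoch q q n * qpoch q y n) * c ^ n\<bar> \<le> C * \<bar>c\<bar> ^ n" for n
      unfolding abs_mult[of _ "c ^ n"] power_abs using C[of n 0] by (intro mult_right_mono) auto
  qed (use c in auto)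
qed

text \<open>The factorials in \<open>A * q ^ N\<close> and \<open>y * q ^ N\<close> tend to 1, which
  leaves a q-binomial series in \<open>d\<close>. This is the boundary value for iterations in
  \<open>A\<close>.\<close>

lemma phi21_shift_tendsto:
  fixes A c d y :: real
  assumes "qpoch_inf q y \<noteq> 0" and c: "\<bar>c\<bar> < 1"
  shows "(\<lambda>N. \<Sum>n. qpoch q d n * qpoch q (A * q ^ N) n / (qpoch q q n * qpoch q (y * q ^ N) n) * c ^ n)
    \<longlonglongrightarrow> qpoch_inf q (d * c) / qpoch_inf q c"
proof -
  obtain C where
    C: "\<And>N n. \<bar>qpoch q d n * qpoch q (A * q ^ N) n / (qpoch q q n * qpoch q (y * q ^ N) n)\<bar> \<le> C"
    by (rule phi21_bound[OF assms(1)]) blast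
  show ?thesis
    unfolding q_binomial[OF c, symmetric]
  proof (rule tendsto_suminf_geometric_bound)
    fix n
    have "(\<lambda>N. qpoch q d n * qpoch q (A * q ^ N) n / (qpoch q q n * qpoch q (y * q ^ N) n) * c ^ n)
        \<longlonglongrightarrow> qpoch q d n * 1 / (qpoch q q n * 1) * c ^ n"
      by (intro tendsto_intros qpoch_shift_tendsto_1) simp
    then show "(\<lambda>N. qpoch q d n * qpoch q (A * q ^ N) n / (qpoch q q n * qpoch q (y * q ^ N) n) * c ^ n)
        \<longlonglongrightarrow> qpoch q d n / qpoch q q n * c ^ n" by simp
    show "\<bar>qpoch q d n * qpoch q (A * q ^ N) n / (qpoch q q n * qpoch q (y * q ^ N) n) * c ^ n\<bar>
        \<le> C * \<bar>c\<bar> ^ n" for N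
      unfolding abs_mult[of _ "c ^ n"] power_abs using C[of n N] by (intro mult_right_mono) auto
  qed (use c in auto)
qed

section \<open>The q-Gauss sum\<close>

text \<open>The relation between the q-Gauss series at \<open>A\<close> and at \<open>A * q\<close>
  fails term by term, but the difference of its sides telescopes. Since \<open>A\<close> is bound in
  \<open>u\<close>, the lower parameter of \<open>u (A * q)\<close> is
  \<open>A * q * c * d\<close>.\<close>

lemma q_gauss_telescope:
  fixes A c d :: real
  assumes "qpoch_inf q (A * c * d) \<noteq> 0"
  defines "u \<equiv> \<lambda>A n. qpoch q d n * qpoch q A n / (qpoch q q n * qpoch q (A * c * d) n) * c ^ n"
  shows "(\<Sum>k<Suc N. (1 - A * c * d) * u A k - (1 - A * c) * u (A * q) k)
    = A * (qpoch q d (Suc N) * qpoch q (A * q) N / (qpoch q q N * qpoch q (A * c * d * q) N)) * c ^ Suc N"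
proof (induction N)
  case 0
  show ?case by (simp add: u_def qpoch_Suc algebra_simps)
next
  case (Suc N)
  have nz: "1 - A * c * d \<noteq> 0" "1 - A * c * d * q * q ^ N \<noteq> 0" "1 - q * q ^ N \<noteq> 0"
    "qpoch q (A * c * d * q) N \<noteq> 0"
    using qpoch_inf_nonzero_shift(3)[OF assms(1), of 0] qpoch_inf_nonzero_shift(3)[OF assms(1), of "Suc N"]
      qpoch_inf_nonzero_shift(3)[OF qpoch_inf_q_nonzero, of N]
      qpoch_inf_nonzero_shift(2)[OF qpoch_inf_nonzero_shift(1)[OF assms(1), of 1], of N]
    by (simp_all add: mult_ac)
  \<comment> \<open>The induction hypothesis has right side \<open>A * K\<close>. The two new terms
    and the new right side are rational multiples of \<open>K\<close> in \<open>A\<close>,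
    \<open>c\<close>, \<open>d\<close> and \<open>v\<close>, so the step reduces to an identity of
    rational functions.\<close>
  define K where "K = qpoch q d (Suc N) * qpoch q (A * q) N /
    (qpoch q q N * qpoch q (A * c * d * q) N) * c ^ Suc N"
  define v where "v = q * q ^ N"
  have v: "q ^ Suc N = v" by (simp add: v_def)
  have nzv: "1 - v \<noteq> 0" "1 - A * c * d * v \<noteq> 0"
    using nz by (simp_all add: v_def mult_ac)
  have e1: "(1 - A * c * d) * u A (Suc N) = (1 - A) * K / (1 - v)"
    unfolding u_def K_def using nz
    by (simp add: qpoch_Suc_left[of A] qpoch_Suc_left[of "A * c * d"] qpoch_Suc[of q] v_def
        del: power_Suc) (simp add: mult_ac)
  have e2: "u (A * q) (Suc N) = K * (1 - A * v) / ((1 - v) * (1 - A * c * d * v))"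
    unfolding u_def K_def
    by (simp add: qpoch_Suc[of q] qpoch_Suc[of "A * q"] v_def mult_ac
        qpoch_Suc[of "A * (c * (d * q))"] del: power_Suc)
  have e3: "A * (qpoch q d (Suc (Suc N)) * qpoch q (A * q) (Suc N) /
      (qpoch q q (Suc N) * qpoch q (A * c * d * q) (Suc N))) * c ^ Suc (Suc N)
    = A * K * c * (1 - d * v) * (1 - A * v) / ((1 - v) * (1 - A * c * d * v))"
    unfolding qpoch_Suc[of d "Suc N"] v K_def
    by (simp add: qpoch_Suc[of q] qpoch_Suc[of "A * q"] v_def mult_ac
        qpoch_Suc[of "A * (c * (d * q))"])
  have "A * K + ((1 - A) * K / (1 - v) - (1 - A * c) * (K * (1 - A * v) / ((1 - v) * (1 - A * c * d * v))))
     = A * K * c * (1 - d * v) * (1 - A * v) / ((1 - v) * (1 - A * c * d * v))"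
    using nzv by (simp add: divide_simps) algebra
  then show ?case
    unfolding sum.lessThan_Suc[of _ "Suc N"] Suc.IH e1 e2 e3 by (simp add: K_def mult_ac)
qed

text \<open>With lower parameter \<open>A * c * d\<close> the argument of the series is
  \<open>c\<close>, so \<open>A\<close> can move while \<open>c\<close> and \<open>d\<close> stay
  fixed. Each move to \<open>A * q\<close> costs the factor \<open>(1 - A c) / (1 - A c d)\<close>,
  and the limit at \<open>A = 0\<close> is a q-binomial sum.\<close>

theorem q_gauss:
  fixes A c d :: real
  assumes \<gamma>: "qpoch_inf q (A * c * d) \<noteq> 0" and c: "\<bar>c\<bar> < 1"
  shows "(\<Sum>n. qpoch q d n * qpoch q A n / (qpoch q q n * qpoch q (A * c * d) n) * c ^ n)
    = qpoch_inf q (A * c) * qpoch_inf q (c * d) / (qpoch_inf q (A * c * d) * qpoch_inf q c)"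
proof -
  define u where "u A n = qpoch q d n * qpoch q A n / (qpoch q q n * qpoch q (A * c * d) n) * c ^ n"
    for A n
  define G where "G A = (\<Sum>n. u A n)" for A
  have step: "(1 - A * c * d) * G A = (1 - A * c) * G (A * q)"
    if \<gamma>: "qpoch_inf q (A * c * d) \<noteq> 0" for A
  proof -
    have \<gamma>q: "qpoch_inf q (A * c * d * q) \<noteq> 0"
      using qpoch_inf_nonzero_shift(1)[OF \<gamma>, of 1] by simp
    have "summable (u A)" "summable (u (A * q))"
      using summable_phi21[OF \<gamma> c, of d A] summable_phi21[OF \<gamma>q c, of d "A * q"]
      by (simp_all add: u_def[abs_def] mult_ac)
    then have "(\<lambda>k. (1 - A * c * d) * u A k - (1 - A * c) * u (A * q) k)
        sums ((1 - A * c * d) * G A - (1 - A * c) * G (A * q))"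
      unfolding G_def by (intro sums_diff sums_mult summable_sums)
    then have "(\<lambda>N. \<Sum>k<Suc N. (1 - A * c * d) * u A k - (1 - A * c) * u (A * q) k)
        \<longlonglongrightarrow> (1 - A * c * d) * G A - (1 - A * c) * G (A * q)"
      unfolding sums_def by (rule LIMSEQ_Suc)
    \<comment> \<open>The closed form of the partial sums vanishes in the limit:
      \<open>c ^ Suc N\<close> tends to 0 and all other factors converge.\<close>
    moreover have "(\<lambda>N. A * (qpoch q d (Suc N) * qpoch q (A * q) N /
        (qpoch q q N * qpoch q (A * c * d * q) N)) * c ^ Suc N)
      \<longlonglongrightarrow> A * (qpoch_inf q d * qpoch_inf q (A * q) / (qpoch_inf q q * qpoch_inf q (A * c * d * q))) * 0"
      using c \<gamma>q
      by (intro tendsto_intros qpoch_tendsto LIMSEQ_Suc[OF qpoch_tendsto]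
          LIMSEQ_Suc[OF LIMSEQ_power_zero]) auto
    ultimately have "(1 - A * c * d) * G A - (1 - A * c) * G (A * q) = 0"
      unfolding u_def q_gauss_telescope[OF \<gamma>] by (auto dest: LIMSEQ_unique)
    then show ?thesis by simp
  qed
  have iter: "G A * qpoch q (A * c * d) N = qpoch q (A * c) N * G (A * q ^ N)" for N
  proof (induction N)
    case (Suc N)
    have st: "(1 - A * q ^ N * c * d) * G (A * q ^ N) = (1 - A * q ^ N * c) * G (A * q ^ N * q)"
      using qpoch_inf_nonzero_shift(1)[OF \<gamma>, of N] by (intro step) (simp add: mult_ac)
    have "G A * qpoch q (A * c * d) (Suc N)
        = qpoch q (A * c) N * ((1 - A * q ^ N * c * d) * G (A * q ^ N))"
      using Suc by (simp add: qpoch_Suc mult_ac)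
    also have "\<dots> = qpoch q (A * c) (Suc N) * G (A * q ^ Suc N)"
      unfolding st by (simp add: qpoch_Suc mult_ac)
    finally show ?case .
  qed simp
  have "(\<lambda>N. G (A * q ^ N)) \<longlonglongrightarrow> qpoch_inf q (d * c) / qpoch_inf q c"
    using phi21_shift_tendsto[OF \<gamma> c, of d A] by (simp add: G_def u_def mult_ac)
  then have "(\<lambda>N. qpoch q (A * c) N * G (A * q ^ N))
      \<longlonglongrightarrow> qpoch_inf q (A * c) * (qpoch_inf q (d * c) / qpoch_inf q c)"
    by (intro tendsto_mult qpoch_tendsto)
  moreover have "(\<lambda>N. G A * qpoch q (A * c * d) N) \<longlonglongrightarrow> G A * qpoch_inf q (A * c * d)"
    by (intro tendsto_mult qpoch_tendsto tendsto_const)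
  ultimately have "G A * qpoch_inf q (A * c * d) = qpoch_inf q (A * c) * (qpoch_inf q (d * c) / qpoch_inf q c)"
    unfolding iter[symmetric] by (auto dest: LIMSEQ_unique)
  then show ?thesis
    using \<gamma> qpoch_inf_nonzero_small[OF c] by (simp add: G_def u_def[abs_def] field_simps)
qed

section \<open>Heine transformations from a first-order recurrence\<close>

text \<open>Unrolling the recurrence \<open>N\<close> times leaves the remainder
  \<open>qpoch q A N / qpoch q B N * Z ^ N * R N\<close>, which tends to 0 because \<open>R\<close>
  converges. Hence any convergent solution is the series.\<close>

lemma q_recurrence_sums:
  fixes A B Z L :: real and R :: "nat \<Rightarrow> real"
  assumes Z: "\<bar>Z\<bar> < 1" and B: "qpoch_inf q B \<noteq> 0"
    and rec: "\<And>N. R N = 1 + Z * (1 - A * q ^ N) / (1 - B * q ^ N) * R (Suc N)"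
    and lim: "R \<longlonglongrightarrow> L"
  shows "(\<lambda>n. qpoch q A n / qpoch q B n * Z ^ n) sums R 0"
proof -
  let ?t = "\<lambda>n. qpoch q A n / qpoch q B n * Z ^ n"
  have part: "(\<Sum>n<N. ?t n) = R 0 - ?t N * R N" for N
  proof (induction N)
    case (Suc N)
    have "?t N * R N = ?t N + ?t (Suc N) * R (Suc N)"
      by (subst rec) (simp add: qpoch_Suc distrib_left mult_ac)
    with Suc show ?case by simp
  qed simp
  have "(\<lambda>N. R 0 - ?t N * R N) \<longlonglongrightarrow> R 0 - qpoch_inf q A / qpoch_inf q B * 0 * L"
    using Z B by (intro tendsto_intros qpoch_tendsto lim LIMSEQ_power_zero) auto
  then show ?thesis unfolding sums_def part by simp
qed

text \<open>Heine's second transformation with one upper parameter equal to \<open>q\<close>, which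
  cancels \<open>(q)_n\<close> on the left. The right side \<open>R\<close> solves the recurrence of
  the left side; its inhomogeneous term 1 comes from the q-Gauss sum.\<close>

theorem heine_second:
  fixes A c Z :: real
  assumes c: "\<bar>c\<bar> < 1" "c \<noteq> 0" and Z: "\<bar>Z\<bar> < 1"
    and Ac: "qpoch_inf q (A * c) \<noteq> 0" and AZ: "qpoch_inf q (A * Z) \<noteq> 0"
  shows "(\<lambda>n. qpoch q A n / qpoch q (A * c) n * Z ^ n) sums
    (qpoch_inf q c * qpoch_inf q (A * Z) / (qpoch_inf q (A * c) * qpoch_inf q Z) *
     (\<Sum>n. qpoch q (q * Z / c) n * qpoch q A n / (qpoch q q n * qpoch q (A * Z) n) * c ^ n))"
proof -
  define d where "d = q * Z / c"
  define W where "W A = (\<Sum>n. qpoch q d n * qpoch q A n / (qpoch q q n * qpoch q (A * Z) n) * c ^ n)"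
    for A
  define R where "R A = qpoch_inf q c * qpoch_inf q (A * Z) / (qpoch_inf q (A * c) * qpoch_inf q Z) * W A"
    for A
  have cnz: "qpoch_inf q c \<noteq> 0" and Znz: "qpoch_inf q Z \<noteq> 0"
    using c Z by (simp_all add: qpoch_inf_nonzero_small)
  have step: "R A = 1 + Z * (1 - A) / (1 - A * c) * R (A * q)"
    if Ac: "qpoch_inf q (A * c) \<noteq> 0" and AZ: "qpoch_inf q (A * Z) \<noteq> 0" for A
  proof -
    have AZq: "qpoch_inf q (A * Z * q) \<noteq> 0" and Acq: "qpoch_inf q (A * c * q) \<noteq> 0"
      using qpoch_inf_nonzero_shift(1)[OF AZ, of 1] qpoch_inf_nonzero_shift(1)[OF Ac, of 1] by simp_all
    \<comment> \<open>This combination moves the lower parameter of both series to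
      \<open>A * Z * q\<close>, where the q-Gauss sum applies.\<close>
    have termwise: "(1 - A * Z) * (qpoch q d n * qpoch q A n / (qpoch q q n * qpoch q (A * Z) n) * c ^ n)
        - Z * (1 - A) * (qpoch q d n * qpoch q (A * q) n / (qpoch q q n * qpoch q (A * Z * q) n) * c ^ n)
      = (1 - Z) * (qpoch q d n * qpoch q A n / (qpoch q q n * qpoch q (A * Z * q) n) * c ^ n)" for n
    proof -
      have 1: "(1 - A) * qpoch q (A * q) n = qpoch q A n * (1 - A * q ^ n)"
        by (metis qpoch_Suc qpoch_Suc_left)
      have 2: "(1 - A * Z) * qpoch q (A * Z * q) n = qpoch q (A * Z) n * (1 - A * Z * q ^ n)"
        by (metis qpoch_Suc qpoch_Suc_left)
      have nz: "qpoch q (A * Z) n \<noteq> 0" "qpoch q (A * Z * q) n \<noteq> 0"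
        using AZ AZq by (simp_all add: qpoch_inf_nonzero_shift)
      have 3: "(1 - A * Z) / qpoch q (A * Z) n = (1 - A * Z * q ^ n) / qpoch q (A * Z * q) n"
        using 2 nz by (simp add: field_simps)
      have "(1 - A * Z) * (qpoch q d n * qpoch q A n / (qpoch q q n * qpoch q (A * Z) n) * c ^ n)
          - Z * (1 - A) * (qpoch q d n * qpoch q (A * q) n / (qpoch q q n * qpoch q (A * Z * q) n) * c ^ n)
        = qpoch q d n / qpoch q q n * c ^ n * (qpoch q A n * ((1 - A * Z) / qpoch q (A * Z) n)
          - Z * ((1 - A) * qpoch q (A * q) n) / qpoch q (A * Z * q) n)"
        by (simp add: right_diff_distrib mult_ac)
      also have "\<dots> = (1 - Z) * (qpoch q d n * qpoch q A n / (qpoch q q n * qpoch q (A * Z * q) n) * c ^ n)"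
        unfolding 1 3 using nz by (simp add: divide_simps) algebra
      finally show ?thesis .
    qed
    \<comment> \<open>The choice \<open>d = q * Z / c\<close> is exactly what makes the lower
      parameter \<open>A * Z * q\<close> have the q-Gauss form \<open>A * c * d\<close>.\<close>
    have \<gamma>: "A * c * d = A * Z * q" using c by (simp add: d_def)
    have cd: "c * d = Z * q" using c by (simp add: d_def)
    have "(1 - A * Z) * W A - Z * (1 - A) * W (A * q)
      = (\<Sum>n. (1 - A * Z) * (qpoch q d n * qpoch q A n / (qpoch q q n * qpoch q (A * Z) n) * c ^ n)
        - Z * (1 - A) * (qpoch q d n * qpoch q (A * q) n / (qpoch q q n * qpoch q (A * Z * q) n) * c ^ n))"
      unfolding W_def mult.assoc[of A q Z] mult.commute[of q Z] mult.assoc[of A Z q, symmetric]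
      by (intro sums_unique sums_diff sums_mult summable_sums summable_phi21 AZ AZq c)
    also have "\<dots> = (1 - Z) * (\<Sum>n. qpoch q d n * qpoch q A n / (qpoch q q n * qpoch q (A * Z * q) n) * c ^ n)"
      unfolding termwise by (intro suminf_mult summable_phi21 AZq c)
    also have "\<dots> = qpoch_inf q (A * c) * qpoch_inf q Z / (qpoch_inf q (A * Z * q) * qpoch_inf q c)"
      using q_gauss[of A c d] AZq c unfolding \<gamma> cd qpoch_inf_Suc[of Z] by simp
    finally have W: "(1 - A * Z) * W A = Z * (1 - A) * W (A * q)
        + qpoch_inf q (A * c) * qpoch_inf q Z / (qpoch_inf q (A * Z * q) * qpoch_inf q c)"
      by linarith
    have "R A = qpoch_inf q c * qpoch_inf q (A * Z * q) / (qpoch_inf q (A * c) * qpoch_inf q Z)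
        * ((1 - A * Z) * W A)"
      unfolding R_def qpoch_inf_Suc[of "A * Z"] by simp
    also have "\<dots> = 1 + Z * (1 - A) * (qpoch_inf q c * qpoch_inf q (A * Z * q) /
        (qpoch_inf q (A * c) * qpoch_inf q Z)) * W (A * q)"
      unfolding W using Ac AZq cnz Znz by (simp add: field_simps)
    also have "\<dots> = 1 + Z * (1 - A) / (1 - A * c) * R (A * q)"
      unfolding R_def qpoch_inf_Suc[of "A * c"] by (simp add: mult_ac)
    finally show ?thesis .
  qed
  have shift: "qpoch_inf q (A * q ^ N * c) \<noteq> 0" "qpoch_inf q (A * q ^ N * Z) \<noteq> 0" for N
    using qpoch_inf_nonzero_shift(1)[OF Ac, of N] qpoch_inf_nonzero_shift(1)[OF AZ, of N]
    by (simp_all add: mult_ac)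
  have "(\<lambda>n. qpoch q A n / qpoch q (A * c) n * Z ^ n) sums R (A * q ^ 0)"
  proof (rule q_recurrence_sums[where R = "\<lambda>N. R (A * q ^ N)"])
    show "R (A * q ^ N) = 1 + Z * (1 - A * q ^ N) / (1 - A * c * q ^ N) * R (A * q ^ Suc N)" for N
      using step[OF shift, of N] by (simp add: mult_ac)
    have W: "(\<lambda>N. W (A * q ^ N)) \<longlonglongrightarrow> qpoch_inf q (d * c) / qpoch_inf q c"
      using phi21_shift_tendsto[OF AZ c(1), of d A] by (simp add: W_def mult_ac)
    have "(\<lambda>N. qpoch_inf q c * qpoch_inf q (A * Z * q ^ N) /
        (qpoch_inf q (A * c * q ^ N) * qpoch_inf q Z) * W (A * q ^ N))
      \<longlonglongrightarrow> qpoch_inf q c * 1 / (1 * qpoch_inf q Z) * (qpoch_inf q (d * c) / qpoch_inf q c)"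
      using Znz by (intro tendsto_intros W qpoch_inf_shift_tendsto_1 Ac AZ) auto
    then show "(\<lambda>N. R (A * q ^ N))
      \<longlonglongrightarrow> qpoch_inf q c * 1 / (1 * qpoch_inf q Z) * (qpoch_inf q (d * c) / qpoch_inf q c)"
      by (simp add: R_def mult_ac)
  qed (use Z Ac in auto)
  then show ?thesis by (simp add: R_def W_def d_def)
qed

text \<open>Heine's first transformation with one upper parameter equal to \<open>q\<close>. Here
  \<open>A\<close> is the argument of the transformed series, and the inhomogeneous term of the
  recurrence comes from the q-binomial theorem.\<close>

theorem heine_first_geometric:
  fixes A c y :: real
  assumes A: "\<bar>A\<bar> < 1" and y: "\<bar>y\<bar> < 1" and Ac: "qpoch_inf q (A * c) \<noteq> 0"
  shows "(\<lambda>n. qpoch q A n / qpoch q (A * c) n * y ^ n) sums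
    (qpoch_inf q A * qpoch_inf q (y * q) / (qpoch_inf q (A * c) * qpoch_inf q y) *
     (\<Sum>n. qpoch q c n * qpoch q y n / (qpoch q q n * qpoch q (y * q) n) * A ^ n))"
proof -
  define k where "k n = qpoch q c n * qpoch q y n / (qpoch q q n * qpoch q (y * q) n)" for n
  define V where "V A = (\<Sum>n. k n * A ^ n)" for A
  define R where "R A = qpoch_inf q A * qpoch_inf q (y * q) / (qpoch_inf q (A * c) * qpoch_inf q y) * V A"
    for A
  have ynz: "qpoch_inf q y \<noteq> 0" using y by (rule qpoch_inf_nonzero_small)
  then have yq: "qpoch_inf q (y * q) \<noteq> 0" and y1: "1 - y \<noteq> 0"
    using qpoch_inf_Suc[of y] by auto
  have sm: "summable (\<lambda>n. k n * A ^ n)" if "\<bar>A\<bar> < 1" for A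
    unfolding k_def using summable_phi21[OF yq that] .
  \<comment> \<open>The quotient \<open>(y)_n / (y q)_n\<close> collapses to
    \<open>(1 - y) / (1 - y q^n)\<close>; the factor \<open>1 - y * q ^ n\<close> produced by
    \<open>V A - y * V (A * q)\<close> removes the denominator.\<close>
  have k: "k n * (1 - y * q ^ n) = (1 - y) * (qpoch q c n / qpoch q q n)" for n
  proof -
    have e: "qpoch q y n * (1 - y * q ^ n) = (1 - y) * qpoch q (y * q) n"
      by (metis qpoch_Suc qpoch_Suc_left)
    have "k n * (1 - y * q ^ n) =
        qpoch q c n * (qpoch q y n * (1 - y * q ^ n)) / (qpoch q q n * qpoch q (y * q) n)"
      by (simp add: k_def)
    then show ?thesis
      unfolding e using qpoch_inf_nonzero_shift(2)[OF yq, of n] by simp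
  qed
  have step: "R A = 1 + y * (1 - A) / (1 - A * c) * R (A * q)"
    if A: "\<bar>A\<bar> < 1" and Ac: "qpoch_inf q (A * c) \<noteq> 0" for A
  proof -
    have Aq: "\<bar>A * q\<bar> < 1" using abs_shift_le[of A 1] A by simp
    have "V A - y * V (A * q) = (\<Sum>n. k n * A ^ n - y * (k n * (A * q) ^ n))"
      unfolding V_def using sm[OF A] sm[OF Aq]
      by (intro sums_unique sums_diff sums_mult summable_sums)
    also have "\<dots> = (\<Sum>n. (1 - y) * (qpoch q c n / qpoch q q n * A ^ n))"
    proof (rule suminf_cong)
      fix n
      have "k n * A ^ n - y * (k n * (A * q) ^ n) = k n * (1 - y * q ^ n) * A ^ n"
        by (simp add: power_mult_distrib algebra_simps)
      then show "k n * A ^ n - y * (k n * (A * q) ^ n)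
          = (1 - y) * (qpoch q c n / qpoch q q n * A ^ n)"
        unfolding k by simp
    qed
    also have "\<dots> = (1 - y) * (qpoch_inf q (A * c) / qpoch_inf q A)"
      using q_binomial[OF A, of c] suminf_mult[OF summable_q_binomial[OF A, of c], of "1 - y"]
      by (simp add: mult.commute)
    finally have V: "V A = y * V (A * q) + (1 - y) * (qpoch_inf q (A * c) / qpoch_inf q A)"
      by simp
    have Anz: "qpoch_inf q A \<noteq> 0" using A by (rule qpoch_inf_nonzero_small)
    have "R A = 1 + y * (qpoch_inf q A * qpoch_inf q (y * q) /
        (qpoch_inf q (A * c) * qpoch_inf q y)) * V (A * q)"
      unfolding R_def V qpoch_inf_Suc[of y] using Ac Anz yq y1 by (simp add: field_simps)
    also have "\<dots> = 1 + y * (1 - A) / (1 - A * c) * R (A * q)"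
      unfolding R_def qpoch_inf_Suc[of "A * c"] qpoch_inf_Suc[of A] by (simp add: mult_ac)
    finally show ?thesis .
  qed
  have "(\<lambda>n. qpoch q A n / qpoch q (A * c) n * y ^ n) sums R (A * q ^ 0)"
  proof (rule q_recurrence_sums[where R = "\<lambda>N. R (A * q ^ N)"])
    fix N
    have "\<bar>A * q ^ N\<bar> < 1" using abs_shift_le[of A N] A by linarith
    moreover have "qpoch_inf q (A * q ^ N * c) \<noteq> 0"
      using qpoch_inf_nonzero_shift(1)[OF Ac, of N] by (simp add: mult_ac)
    ultimately show "R (A * q ^ N) = 1 + y * (1 - A * q ^ N) / (1 - A * c * q ^ N) * R (A * q ^ Suc N)"
      using step[of "A * q ^ N"] by (simp add: mult_ac)
  next
    obtain C where
      C: "\<And>N n. \<bar>qpoch q c n * qpoch q (y * q ^ N) n / (qpoch q q n * qpoch q (y * q * q ^ N) n)\<bar> \<le> C"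
      by (rule phi21_bound[OF yq]) blast
    have C0: "0 \<le> C" using C[of 0 0] by simp
    have V: "(\<lambda>N. V (A * q ^ N)) \<longlonglongrightarrow> (\<Sum>n. k n * 0 ^ n)"
      unfolding V_def
    proof (rule tendsto_suminf_geometric_bound)
      show "(\<lambda>N. k n * (A * q ^ N) ^ n) \<longlonglongrightarrow> k n * 0 ^ n" for n
        by (intro tendsto_intros mult_power_tendsto_0)
      show "\<bar>k n * (A * q ^ N) ^ n\<bar> \<le> C * \<bar>A\<bar> ^ n" for N n
        unfolding abs_mult[of "k n"] power_abs
        using C0 C[of n 0] abs_shift_le[of A N] by (intro mult_mono power_mono) (auto simp: k_def)
    qed (use A in auto)
    have "(\<lambda>N. qpoch_inf q (A * q ^ N) * qpoch_inf q (y * q) /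
        (qpoch_inf q (A * c * q ^ N) * qpoch_inf q y) * V (A * q ^ N))
      \<longlonglongrightarrow> 1 * qpoch_inf q (y * q) / (1 * qpoch_inf q y) * (\<Sum>n. k n * 0 ^ n)"
      using ynz
      by (intro tendsto_intros V qpoch_inf_shift_tendsto_1 Ac qpoch_inf_nonzero_small A) auto
    then show "(\<lambda>N. R (A * q ^ N))
      \<longlonglongrightarrow> 1 * qpoch_inf q (y * q) / (1 * qpoch_inf q y) * (\<Sum>n. k n * 0 ^ n)"
      by (simp add: R_def mult_ac)
  qed (use y Ac in auto)
  then show ?thesis by (simp add: R_def V_def k_def)
qed

section \<open>Ramanujan's 1psi1 summation\<close>

text \<open>The second sum holds the terms of negative index, by
  \<open>(A)_(-m) / (B)_(-m) = (q/B)_m / (q/A)_m (B/A)^m\<close>. The hypothesis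
  \<open>q < \<bar>A * Z\<bar>\<close> puts the evaluation point \<open>b = q\<close> inside the
  region of convergence.\<close>

theorem ramanujan_1psi1:
  fixes A B Z :: real
  assumes Z: "\<bar>Z\<bar> < 1" and B: "B \<noteq> 0" "\<bar>B\<bar> < \<bar>A * Z\<bar>" "qpoch_inf q B \<noteq> 0"
    and qAZ: "q < \<bar>A * Z\<bar>" and qA: "qpoch_inf q (q / A) \<noteq> 0"
  shows "(\<Sum>n. qpoch q A n / qpoch q B n * Z ^ n)
      + (\<Sum>n. qpoch q (q / B) (Suc n) / qpoch q (q / A) (Suc n) * (B / (A * Z)) ^ Suc n)
    = qpoch_inf q q * qpoch_inf q (B / A) * qpoch_inf q (A * Z) * qpoch_inf q (q / (A * Z)) /
      (qpoch_inf q B * qpoch_inf q (q / A) * qpoch_inf q Z * qpoch_inf q (B / (A * Z)))"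
proof -
  \<comment> \<open>The disc of radius \<open>r\<close> contains both \<open>B\<close> and
    \<open>q\<close> as well as their shifts, and \<open>r < \<bar>A * Z\<bar>\<close> gives one
    ratio \<open>\<rho>\<close> for all negative parts.\<close>
  define r where "r = max \<bar>B\<bar> q"
  have r: "0 < r" "r < \<bar>A * Z\<bar>" "\<bar>B\<bar> \<le> r" "\<bar>q\<bar> \<le> r"
    unfolding r_def using B qAZ q_pos by auto
  have A0: "A \<noteq> 0" and Z0: "Z \<noteq> 0"
    using r(1,2) by auto
  define \<rho> where "\<rho> = r / \<bar>A * Z\<bar>"
  have \<rho>_nonneg: "0 \<le> \<rho>"
    unfolding \<rho>_def by (rule divide_nonneg_nonneg[OF less_imp_le[OF r(1)] abs_ge_zero])
  have \<rho>_less_1: "\<rho> < 1"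
    unfolding \<rho>_def using divide_less_eq_1_pos[OF less_trans[OF r(1,2)]] r(2) by (rule iffD2)
  note \<rho> = \<rho>_nonneg \<rho>_less_1
  \<comment> \<open>\<open>s b m\<close> is the term of index \<open>-m\<close>, in a form that makes sense at \<open>b = 0\<close>.\<close>
  define s where "s b m = (\<Prod>k<m. b - q * q ^ k) / (qpoch q (q / A) m * (A * Z) ^ m)" for b m
  define t where "t b n = qpoch q A n / qpoch q b n * Z ^ n" for b n
  define f where "f b = (\<Sum>n. t b n) + (\<Sum>m. s b (Suc m))" for b
  obtain L where L: "L > 0" "\<And>N n. L \<le> \<bar>qpoch q (q / A * q ^ N) n\<bar>"
    using qpoch_lower_bound[OF qA] by blast
  \<comment> \<open>Each numerator factor of \<open>s\<close> is at most
    \<open>r * (1 + q / r * q ^ k)\<close>, which yields \<open>r ^ m\<close> times a bounded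
    product; \<open>L\<close> controls the denominator.\<close>
  define C where "C = qpoch_inf q (- (q / r)) / L"
  have s_bound: "\<bar>s b m\<bar> \<le> C * \<rho> ^ m" if b: "\<bar>b\<bar> \<le> r" for b m
  proof -
    have "\<bar>\<Prod>k<m. b - q * q ^ k\<bar> \<le> (\<Prod>k<m. r * (1 - (- (q / r)) * q ^ k))"
      unfolding abs_prod
    proof (intro prod_mono conjI)
      fix k
      have "\<bar>b - q * q ^ k\<bar> \<le> r + q * q ^ k"
        using b q_pos by (intro order.trans[OF abs_triangle_ineq4]) auto
      moreover have "r * (1 - (- (q / r)) * q ^ k) = r + q * q ^ k"
        using r by (simp add: field_simps)
      ultimately show "\<bar>b - q * q ^ k\<bar> \<le> r * (1 - (- (q / r)) * q ^ k)" by simp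
    qed auto
    also have "\<dots> = r ^ m * qpoch q (- (q / r)) m"
      by (simp add: prod.distrib qpoch_prod)
    also have "\<dots> \<le> r ^ m * qpoch_inf q (- (q / r))"
      using r q_pos abs_qpoch_le[of "- (q / r)" "q / r" m] by (intro mult_left_mono) auto
    finally have num: "\<bar>\<Prod>k<m. b - q * q ^ k\<bar> \<le> r ^ m * qpoch_inf q (- (q / r))" .
    have "\<bar>s b m\<bar> \<le> r ^ m * qpoch_inf q (- (q / r)) / (L * \<bar>A * Z\<bar> ^ m)"
      unfolding s_def abs_divide abs_mult[of "qpoch q (q / A) m"] power_abs
      using num L(1) L(2)[of 0 m] A0 Z0 by (intro frac_le mult_mono) auto
    also have "\<dots> = C * \<rho> ^ m" by (simp add: C_def \<rho>_def power_divide)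
    finally show ?thesis .
  qed
  have s_bound': "\<bar>s b (Suc m)\<bar> \<le> C * \<rho> * \<rho> ^ m" if "\<bar>b\<bar> \<le> r" for b m
    using s_bound[OF that, of "Suc m"] by (simp add: mult_ac)
  have s_sm: "summable (\<lambda>m. s b (Suc m))" if "\<bar>b\<bar> \<le> r" for b
    using s_bound'[OF that] \<rho> by (rule summable_geometric_bound)
  \<comment> \<open>The constant depends on \<open>b\<close> through a lower bound for the
    denominators, but it is uniform along the shifts \<open>b * q ^ N\<close>.\<close>
  have t_bound: "\<exists>D. \<forall>N n. \<bar>t (b * q ^ N) n\<bar> \<le> D * \<bar>Z\<bar> ^ n" if b: "qpoch_inf q b \<noteq> 0" for b
  proof -
    obtain D where D: "\<And>N M n. \<bar>qpoch q (A * q ^ N) n / qpoch q (b * q ^ M) n\<bar> \<le> D"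
      using qpoch_ratio_bound[OF b, of A] by metis
    have "\<bar>t (b * q ^ N) n\<bar> \<le> D * \<bar>Z\<bar> ^ n" for N n
      unfolding t_def abs_mult[of _ "Z ^ n"] power_abs using D[of 0 n N]
      by (intro mult_right_mono) auto
    then show ?thesis by blast
  qed
  have t_sm: "summable (t b)" if b: "qpoch_inf q b \<noteq> 0" for b
  proof -
    obtain D where D: "\<And>N n. \<bar>t (b * q ^ N) n\<bar> \<le> D * \<bar>Z\<bar> ^ n" using t_bound[OF b] by blast
    show ?thesis
    proof (rule summable_geometric_bound)
      show "\<bar>t b n\<bar> \<le> D * \<bar>Z\<bar> ^ n" for n using D[of 0 n] by simp
    qed (use Z in auto)
  qed
  have step: "(1 - b) * (1 - b / (A * Z)) * f b = (1 - b / A) * f (b * q)"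
    if b: "qpoch_inf q b \<noteq> 0" "\<bar>b\<bar> \<le> r" for b
  proof -
    have bq: "qpoch_inf q (b * q) \<noteq> 0" "\<bar>b * q\<bar> \<le> r"
      using qpoch_inf_nonzero_shift(1)[OF b(1), of 1] abs_shift_le[of b 1] b(2) by auto
    \<comment> \<open>In bilateral indexing this is the same relation as \<open>s_step\<close>: the
      combination at index n is a constant times the term at index n + 1.\<close>
    have t_step: "(1 - b) * t b n - (1 - b / A) * t (b * q) n = (1 - b) * b / (A * Z) * t b (Suc n)" for n
    proof -
      have nz: "qpoch q b n \<noteq> 0" "1 - b * q ^ n \<noteq> 0" "1 - b \<noteq> 0"
        using qpoch_inf_nonzero_shift[OF b(1), of n] qpoch_inf_nonzero_shift(3)[OF b(1), of 0] by auto
      have "(1 - b) * qpoch q (b * q) n = qpoch q b n * (1 - b * q ^ n)"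
        by (metis qpoch_Suc qpoch_Suc_left)
      then have e: "qpoch q (b * q) n = qpoch q b n * (1 - b * q ^ n) / (1 - b)"
        using nz by (simp add: field_simps)
      show ?thesis
        unfolding t_def e qpoch_Suc power_Suc using nz A0 Z0
        by (simp add: divide_simps) algebra
    qed
    have s_step: "(1 - b) * s b (Suc m) - (1 - b / A) * s (b * q) (Suc m)
        = (1 - b) * b / (A * Z) * s b m" for m
    proof -
      define p where "p = (\<Prod>k<m. b - q * q ^ k)"
      \<comment> \<open>Apart from its first factor, the product at \<open>b * q\<close> is
        \<open>q ^ m\<close> times the product at \<open>b\<close>, so all three terms of the
        relation are multiples of \<open>p\<close>.\<close>
      have "(\<Prod>k<m. b * q - q * (q * q ^ k)) = (\<Prod>k<m. q * (b - q * q ^ k))"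
        by (intro prod.cong) (auto simp: algebra_simps)
      then have p1: "(\<Prod>k<m. b * q - q * (q * q ^ k)) = q ^ m * p"
        by (simp add: prod.distrib p_def)
      have p2: "(\<Prod>k<Suc m. b * q - q * q ^ k) = q * (b - 1) * (q ^ m * p)"
        unfolding prod.lessThan_Suc_shift power_Suc p1 by (simp add: algebra_simps)
      have p3: "(\<Prod>k<Suc m. b - q * q ^ k) = p * (b - q * q ^ m)"
        by (simp add: p_def)
      have nz: "qpoch q (q / A) m \<noteq> 0" "1 - q / A * q ^ m \<noteq> 0"
        using qpoch_inf_nonzero_shift[OF qA, of m] by auto
      then have nz': "A - q * q ^ m \<noteq> 0" using A0 by (auto simp: field_simps)
      have e: "1 - q / A * q ^ m = (A - q * q ^ m) / A" using A0 by (simp add: field_simps)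
      show ?thesis
        unfolding s_def p2 p3 p_def[symmetric] qpoch_Suc power_Suc e
        using nz nz' A0 Z0 by (simp add: divide_simps) algebra
    qed
    have "(1 - b) * (\<Sum>n. t b n) - (1 - b / A) * (\<Sum>n. t (b * q) n)
        = (\<Sum>n. (1 - b) * b / (A * Z) * t b (Suc n))"
      unfolding t_step[symmetric] using t_sm b(1) bq(1)
      by (intro sums_unique sums_diff sums_mult summable_sums) auto
    also have "\<dots> = (1 - b) * b / (A * Z) * ((\<Sum>n. t b n) - 1)"
      using suminf_split_head[OF t_sm[OF b(1)]]
      by (subst suminf_mult[OF t_sm[OF b(1), THEN summable_Suc_iff[THEN iffD2]]])
         (simp add: t_def[of b 0])
    finally have P: "(1 - b) * (\<Sum>n. t b n) - (1 - b / A) * (\<Sum>n. t (b * q) n)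
        = (1 - b) * b / (A * Z) * ((\<Sum>n. t b n) - 1)" .
    have sm0: "summable (s b)" using s_sm[OF b(2)] summable_Suc_iff by blast
    have "(1 - b) * (\<Sum>m. s b (Suc m)) - (1 - b / A) * (\<Sum>m. s (b * q) (Suc m))
        = (\<Sum>m. (1 - b) * b / (A * Z) * s b m)"
      unfolding s_step[symmetric] using s_sm b(2) bq(2)
      by (intro sums_unique sums_diff sums_mult summable_sums) auto
    also have "\<dots> = (1 - b) * b / (A * Z) * (1 + (\<Sum>m. s b (Suc m)))"
      using suminf_split_head[OF sm0] by (subst suminf_mult[OF sm0]) (simp add: s_def[of b 0])
    finally have N: "(1 - b) * (\<Sum>m. s b (Suc m)) - (1 - b / A) * (\<Sum>m. s (b * q) (Suc m))
        = (1 - b) * b / (A * Z) * (1 + (\<Sum>m. s b (Suc m)))" .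
    \<comment> \<open>The index shift takes the term 1 of index 0 out of the nonnegative half and
      puts it into the negative half; the \<open>- 1\<close> in \<open>P\<close> and the
      \<open>1 +\<close> in \<open>N\<close> cancel.\<close>
    have "(1 - b) * f b - (1 - b / A) * f (b * q) = (1 - b) * b / (A * Z) * f b"
      using arg_cong2[OF P N, of "(+)"] unfolding f_def
      by (simp only: distrib_left right_diff_distrib)
    then show ?thesis by (simp add: algebra_simps)
  qed
  define f0 where "f0 = (\<Sum>n. t 0 n) + (\<Sum>m. s 0 (Suc m))"
  have key: "f b * (qpoch_inf q b * qpoch_inf q (b / (A * Z))) = qpoch_inf q (b / A) * f0"
    if b: "qpoch_inf q b \<noteq> 0" "\<bar>b\<bar> \<le> r" for b
  proof -
    have sh: "\<bar>b * q ^ N\<bar> \<le> r" for N using abs_shift_le[of b N] b(2) by linarith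
    have iter: "f b * (qpoch q b N * qpoch q (b / (A * Z)) N) = qpoch q (b / A) N * f (b * q ^ N)" for N
    proof (induction N)
      case (Suc N)
      have st: "(1 - b * q ^ N) * (1 - b * q ^ N / (A * Z)) * f (b * q ^ N)
          = (1 - b * q ^ N / A) * f (b * q ^ N * q)"
        by (intro step sh qpoch_inf_nonzero_shift b)
      have "f b * (qpoch q b (Suc N) * qpoch q (b / (A * Z)) (Suc N))
          = qpoch q (b / A) N * ((1 - b * q ^ N) * (1 - b * q ^ N / (A * Z)) * f (b * q ^ N))"
        using Suc by (simp add: qpoch_Suc mult_ac)
      also have "\<dots> = qpoch q (b / A) (Suc N) * f (b * q ^ Suc N)"
        unfolding st by (simp add: qpoch_Suc mult_ac)
      finally show ?case .
    qed simp
    obtain D where D: "\<And>N n. \<bar>t (b * q ^ N) n\<bar> \<le> D * \<bar>Z\<bar> ^ n" using t_bound[OF b(1)] by blast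
    have "(\<lambda>N. \<Sum>n. t (b * q ^ N) n) \<longlonglongrightarrow> (\<Sum>n. t 0 n)"
    proof (rule tendsto_suminf_geometric_bound[OF _ D])
      fix n
      have "(\<lambda>N. qpoch q A n / qpoch q (b * q ^ N) n * Z ^ n) \<longlonglongrightarrow> qpoch q A n / 1 * Z ^ n"
        by (intro tendsto_intros qpoch_shift_tendsto_1) simp
      then show "(\<lambda>N. t (b * q ^ N) n) \<longlonglongrightarrow> t 0 n" by (simp add: t_def)
    qed (use Z in auto)
    moreover have "(\<lambda>N. \<Sum>m. s (b * q ^ N) (Suc m)) \<longlonglongrightarrow> (\<Sum>m. s 0 (Suc m))"
    proof (rule tendsto_suminf_geometric_bound[OF _ s_bound'[OF sh] \<rho>])
      show "(\<lambda>N. s (b * q ^ N) (Suc m)) \<longlonglongrightarrow> s 0 (Suc m)" for m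
        unfolding s_def
        using qpoch_inf_nonzero_shift(2)[OF qA, of "Suc m"] A0 Z0
        by (intro tendsto_intros mult_power_tendsto_0) auto
    qed
    ultimately have "(\<lambda>N. f (b * q ^ N)) \<longlonglongrightarrow> f0"
      unfolding f_def f0_def by (rule tendsto_add)
    then have "(\<lambda>N. qpoch q (b / A) N * f (b * q ^ N)) \<longlonglongrightarrow> qpoch_inf q (b / A) * f0"
      by (intro tendsto_mult qpoch_tendsto)
    moreover have "(\<lambda>N. f b * (qpoch q b N * qpoch q (b / (A * Z)) N))
        \<longlonglongrightarrow> f b * (qpoch_inf q b * qpoch_inf q (b / (A * Z)))"
      by (intro tendsto_mult qpoch_tendsto tendsto_const)
    ultimately show ?thesis unfolding iter by (auto dest: LIMSEQ_unique)
  qed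
  \<comment> \<open>At \<open>b = q\<close> the factor with k = 0 is \<open>q - q\<close>, so the
    negative half vanishes and a q-binomial series remains; \<open>key\<close> at \<open>q\<close>
    then gives \<open>f0\<close>.\<close>
  have "s q (Suc m) = 0" for m
    by (simp add: s_def prod.lessThan_Suc_shift del: prod.lessThan_Suc)
  then have "f q = qpoch_inf q (A * Z) / qpoch_inf q Z"
    using q_binomial[OF Z, of A] by (simp add: f_def t_def)
  then have f0: "f0 = qpoch_inf q (A * Z) / qpoch_inf q Z * (qpoch_inf q q * qpoch_inf q (q / (A * Z)))
      / qpoch_inf q (q / A)"
    using key[of q] r qA by (simp add: field_simps)
  have fB: "f B = qpoch_inf q (B / A) * f0 / (qpoch_inf q B * qpoch_inf q (B / (A * Z)))"
  proof -
    have "qpoch_inf q (B / (A * Z)) \<noteq> 0"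
      using B by (intro qpoch_inf_nonzero_small) (simp add: abs_divide divide_less_eq)
    then show ?thesis using key[OF B(3) r(3)] B by (simp add: field_simps)
  qed
  have sB: "s B m = qpoch q (q / B) m / qpoch q (q / A) m * (B / (A * Z)) ^ m" for m
  proof -
    have "(\<Prod>k<m. B - q * q ^ k) = (\<Prod>k<m. B * (1 - q / B * q ^ k))"
      using B by (intro prod.cong) (auto simp: field_simps)
    then have "(\<Prod>k<m. B - q * q ^ k) = B ^ m * qpoch q (q / B) m"
      by (simp add: prod.distrib qpoch_prod)
    then show ?thesis by (simp add: s_def power_divide)
  qed
  have "(\<Sum>n. qpoch q A n / qpoch q B n * Z ^ n)
      + (\<Sum>n. qpoch q (q / B) (Suc n) / qpoch q (q / A) (Suc n) * (B / (A * Z)) ^ Suc n) = f B"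
    by (simp only: f_def t_def sB)
  also have "\<dots> = qpoch_inf q q * qpoch_inf q (B / A) * qpoch_inf q (A * Z) * qpoch_inf q (q / (A * Z)) /
      (qpoch_inf q B * qpoch_inf q (q / A) * qpoch_inf q Z * qpoch_inf q (B / (A * Z)))"
    unfolding fB f0 by (simp add: mult_ac)
  finally show ?thesis .
qed

section \<open>Translation to the q-gamma function\<close>

text \<open>A factor \<open>1 - q powr (x + k)\<close> vanishes only at \<open>x = - k\<close>;
  these are the real poles of \<open>Gamma_q\<close>.\<close>

lemma qpoch_inf_powr_nonzero:
  fixes x :: real
  assumes "x \<notin> \<int>\<^sub>\<le>\<^sub>0"
  shows "qpoch_inf q (q powr x) \<noteq> 0"
proof (rule qpoch_inf_nonzero)
  fix k
  have "q powr x * q ^ k = q powr (x + real k)"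
    using q_pos by (simp add: powr_add powr_realpow)
  moreover have "x + real k \<noteq> 0"
  proof
    assume "x + real k = 0"
    then have "x = - of_nat k" by simp
    with assms show False by simp
  qed
  ultimately show "q powr x * q ^ k \<noteq> 1"
    using q_pos q_less_1 by simp
qed

lemma q_powr_less_1: "x > 0 \<Longrightarrow> q powr x < 1"
  using powr_less_mono'[of q 0 x] q_pos q_less_1 by simp

end

text \<open>The inequalities make every argument of \<open>Gamma_q\<close> positive except
  \<open>b\<close> and \<open>a + z\<close>. The two non-integrality conditions keep these off the
  poles, where division by zero would give \<open>Gamma_q\<close> the value 0.\<close>

theorem theorem5p1:
  fixes q a b z :: real
  assumes "0 < q" and "q < 1"
    and "0 < z" and "z < b - a" and "b - a < 1" and "b < 1"
    and "b \<notin> \<int>\<^sub>\<le>\<^sub>0" and "a + z \<notin> \<int>\<^sub>\<le>\<^sub>0"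
  shows
    "Gamma_q q b * Gamma_q q (1 - a) * Gamma_q q z * Gamma_q q (b - a - z) /
       (Gamma_q q (b - a) * Gamma_q q (a + z) * Gamma_q q (1 - a - z)) =
     - ((1 - q) powr (a + 1 - b))
     + (1 - q) powr (a + 1 - b) *
         (Gamma_q q b * Gamma_q q z / (Gamma_q q (b - a) * Gamma_q q (a + z))) *
         (\<Sum>n. qpoch q (q powr (a + 1 + z - b)) n * qpoch q (q powr a) n /
                (qpoch q q n * qpoch q (q powr (a + z)) n) * (q powr (b - a)) ^ n)
     + Gamma_q q (1 - a) * Gamma_q q (b - a - z) /
         (Gamma_q q (1 - b) * Gamma_q q (b + 1 - a - z)) *
         (\<Sum>n. qpoch q (q powr (b - a)) n * qpoch q (q powr (b - z - a)) n /
                (qpoch q (q powr (b + 1 - a - z)) n * qpoch q q n) * (q powr (1 - b)) ^ n)"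
proof -
  interpret q_base q using assms by unfold_locales
  define A B Z where "A = q powr a" and "B = q powr b" and "Z = q powr z"
  define I :: "real \<Rightarrow> real" where "I = qpoch_inf q"
  define h where "h = 1 - q"
  have pos: "A > 0" "B > 0" "Z > 0" "h > 0" using assms by (simp_all add: A_def B_def Z_def h_def)
  \<comment> \<open>The last power keeps the form \<open>q * Z / (B / A)\<close> to match
    \<open>heine_second\<close> with \<open>c = B / A\<close>.\<close>
  have pw: "q powr (1 - a) = q / A" "q powr (b - a - z) = B / (A * Z)" "q powr (b - a) = B / A"
    "q powr (a + z) = A * Z" "q powr (1 - a - z) = q / (A * Z)" "q powr (1 - b) = q / B"
    "q powr (b + 1 - a - z) = B / (A * Z) * q" "q powr (b - z - a) = B / (A * Z)"
    "q powr (a + 1 + z - b) = q * Z / (B / A)"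
    using \<open>0 < q\<close> by (simp_all add: A_def B_def Z_def powr_diff powr_add)
  note pw = pw A_def[symmetric] B_def[symmetric] Z_def[symmetric]
  have small: "\<bar>q powr x\<bar> < 1" if "x > 0" for x
    using q_powr_less_1[OF that] by simp
  have lt: "\<bar>Z\<bar> < 1" "\<bar>B / A\<bar> < 1" "\<bar>B / (A * Z)\<bar> < 1" "\<bar>q / B\<bar> < 1" "\<bar>q / A\<bar> < 1"
    "\<bar>q / (A * Z)\<bar> < 1"
    using small[of z] small[of "b - a"] small[of "b - a - z"] small[of "1 - b"] small[of "1 - a"]
      small[of "1 - a - z"] assms unfolding pw by simp_all
  have nzB: "qpoch_inf q B \<noteq> 0" and nzAZ: "qpoch_inf q (A * Z) \<noteq> 0"
    using qpoch_inf_powr_nonzero[OF assms(7)] qpoch_inf_powr_nonzero[OF assms(8)] unfolding pw .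
  have nz: "I q \<noteq> 0" "I B \<noteq> 0" "I (A * Z) \<noteq> 0" "I Z \<noteq> 0" "I (B / A) \<noteq> 0" "I (B / (A * Z)) \<noteq> 0"
    "I (q / B) \<noteq> 0" "I (q / A) \<noteq> 0" "I (q / (A * Z)) \<noteq> 0"
    unfolding I_def using lt nzB nzAZ by (simp_all add: qpoch_inf_nonzero_small del: abs_divide)
  have nzyq: "I (B / (A * Z) * q) \<noteq> 0"
    using qpoch_inf_nonzero_shift(1)[of "B / (A * Z)" 1] nz(6) by (simp add: I_def)
  define S1 where "S1 = (\<Sum>n. qpoch q (q * Z / (B / A)) n * qpoch q A n /
      (qpoch q q n * qpoch q (A * Z) n) * (B / A) ^ n)"
  define S2 where "S2 = (\<Sum>n. qpoch q (B / A) n * qpoch q (B / (A * Z)) n /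
      (qpoch q (B / (A * Z) * q) n * qpoch q q n) * (q / B) ^ n)"
  \<comment> \<open>Both transformations use \<open>c = B / A\<close>: it turns the upper parameter
    \<open>A\<close> into the lower parameter \<open>B\<close>, and \<open>q / B\<close> into
    \<open>q / A\<close>.\<close>
  have AB: "A * (B / A) = B" "q / B * (B / A) = q / A" using pos by simp_all
  have "(\<lambda>n. qpoch q A n / qpoch q B n * Z ^ n) sums
      (I (B / A) * I (A * Z) / (I B * I Z) * S1)"
    using heine_second[of "B / A" Z A] lt pos nzB nzAZ unfolding AB I_def S1_def by simp
  then have pos_part: "(\<Sum>n. qpoch q A n / qpoch q B n * Z ^ n) = I (B / A) * I (A * Z) / (I B * I Z) * S1"
    by (rule sums_unique[symmetric])
  have "(\<lambda>n. qpoch q (q / B) n / qpoch q (q / A) n * (B / (A * Z)) ^ n) sums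
      (I (q / B) * I (B / (A * Z) * q) / (I (q / A) * I (B / (A * Z))) * S2)"
    using heine_first_geometric[of "q / B" "B / (A * Z)" "B / A"] lt nz(8)
    unfolding AB I_def S2_def by (simp add: mult.commute)
  \<comment> \<open>The transformed series starts at index 0, whose term is 1; it already belongs to
    the nonnegative part.\<close>
  then have neg_part: "(\<Sum>n. qpoch q (q / B) (Suc n) / qpoch q (q / A) (Suc n) * (B / (A * Z)) ^ Suc n)
      = I (q / B) * I (B / (A * Z) * q) / (I (q / A) * I (B / (A * Z))) * S2 - 1"
    using suminf_split_head[OF sums_summable] sums_unique by fastforce
  have psi: "I (B / A) * I (A * Z) / (I B * I Z) * S1
      + (I (q / B) * I (B / (A * Z) * q) / (I (q / A) * I (B / (A * Z))) * S2 - 1)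
    = I q * I (B / A) * I (A * Z) * I (q / (A * Z)) / (I B * I (q / A) * I Z * I (B / (A * Z)))"
    unfolding pos_part[symmetric] neg_part[symmetric] unfolding I_def
  proof (rule ramanujan_1psi1)
    \<comment> \<open>These come from \<open>b - a - z > 0\<close> and \<open>b < 1\<close>;
      chained, they give \<open>q < A * Z\<close>.\<close>
    have "B < A * Z" "q < B" using lt pos by (simp_all add: field_simps)
    then show "\<bar>B\<bar> < \<bar>A * Z\<bar>" "q < \<bar>A * Z\<bar>" using pos by simp_all
  qed (use lt pos nz in \<open>auto simp: I_def\<close>)
  have G: "Gamma_q q x = I q / I (q powr x) * (h / h powr x)" for x
    unfolding Gamma_q_def I_def h_def using assms by (simp add: powr_diff)
  define \<alpha> \<beta> \<zeta> where "\<alpha> = h powr a" and "\<beta> = h powr b" and "\<zeta> = h powr z"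
  have pos': "\<alpha> > 0" "\<beta> > 0" "\<zeta> > 0" using pos by (simp_all add: \<alpha>_def \<beta>_def \<zeta>_def)
  have hp: "h powr (1 - a) = h / \<alpha>" "h powr (b - a - z) = \<beta> / (\<alpha> * \<zeta>)" "h powr (b - a) = \<beta> / \<alpha>"
    "h powr (a + z) = \<alpha> * \<zeta>" "h powr (1 - a - z) = h / (\<alpha> * \<zeta>)" "h powr (1 - b) = h / \<beta>"
    "h powr (b + 1 - a - z) = \<beta> / (\<alpha> * \<zeta>) * h" "h powr (a + 1 - b) = \<alpha> * h / \<beta>"
    using \<open>0 < h\<close> by (simp_all add: \<alpha>_def \<beta>_def \<zeta>_def powr_diff powr_add)
  note hp = hp \<alpha>_def[symmetric] \<beta>_def[symmetric] \<zeta>_def[symmetric]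
  have g0: "Gamma_q q b * Gamma_q q (1 - a) * Gamma_q q z * Gamma_q q (b - a - z) /
       (Gamma_q q (b - a) * Gamma_q q (a + z) * Gamma_q q (1 - a - z))
     = h powr (a + 1 - b) *
       (I q * I (B / A) * I (A * Z) * I (q / (A * Z)) / (I B * I (q / A) * I Z * I (B / (A * Z))))"
    unfolding G pw hp using nz pos pos' by (simp add: divide_simps mult_ac)
  have g1: "Gamma_q q b * Gamma_q q z / (Gamma_q q (b - a) * Gamma_q q (a + z))
      = I (B / A) * I (A * Z) / (I B * I Z)"
    unfolding G pw hp using nz pos pos' by (simp add: divide_simps mult_ac)
  have g2: "Gamma_q q (1 - a) * Gamma_q q (b - a - z) / (Gamma_q q (1 - b) * Gamma_q q (b + 1 - a - z))
      = h powr (a + 1 - b) * (I (q / B) * I (B / (A * Z) * q) / (I (q / A) * I (B / (A * Z))))"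
    unfolding G pw hp using nz nzyq pos pos' by (simp add: divide_simps mult_ac)
  \<comment> \<open>What remains is \<open>psi\<close> multiplied by
    \<open>h powr (a + 1 - b)\<close>.\<close>
  show ?thesis
    unfolding g0 g1 g2 psi[symmetric] h_def[symmetric]
    unfolding pw S1_def[symmetric] S2_def[symmetric]
    by (simp add: algebra_simps)
qed

end
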